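(* Let $M$ be a subdistribution matrix of shape $(X,Y)$. The following are equivalent: 1. $M$ is a subpermutation matrix; 2. $M$ is a partial isomorphism, i.e. $M$ has a partial inverse. In that case, a partial inverse of $M$ is given by the transpose $M^{\mathsf T}$.
   Context: Composition is in diagrammatic order. A matrix of shape $(X,Y)$, for arbitrary sets $X,Y$, is a function $M\colon X\times Y\to\mathbb R$ with rows $M_{x,-}$. A subdistribution on $X$ is a finitely supported function $p\colon X\to[0,1]$ with $\sum_xp_x\le1$. A subdistribution matrix is a matrix whose rows are all subdistributions. $(MN)_{x,z}=\sum_yM_{x,y}N_{y,z}$. $\operatorname{supp}M=\{x\in X:\exists y\in Y,\ M_{x,y}\neq0\}$. The transpose $M^{\mathsf T}$ has shape $(Y,X)$ and entries $(M^{\mathsf T})_{y,x}=M_{x,y}$. The unit distribution $\delta_y$ on $Y$ takes value $1$ at $y$ and $0$ elsewhere. $\mathbf 1$ is a one-point set. A subdistribution matrix $M$ is a subpermutation matrix if (i) for all $x\in\operatorname{supp}M$ the row $M_{x,-}$ is a unit distribution, and (ii) for all $x,x'\in\operatorname{supp}M$, $M_{x,-}=M_{x',-}$ if and only if $x=x'$. Kronecker product: $(M\otimes N)_{(x,u),(y,v)}=M_{x,y}N_{u,v}$. Copy matrix $\Delta_X$ of shape $(X,X\times X)$: entry $1$ at $(x,(x_1,x_2))$ if $x_1=x=x_2$, else $0$. Discard matrix $E_Y$ of shape $(Y,\mathbf 1)$: all entries $1$. The domain of definition of a subdistribution matrix $M$ of shape $(X,Y)$ is $\overline M=\Delta_X(\mathrm{id}_X\otimes(ME_Y))$,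 of shape $(X,X)$ (identifying $X\times\mathbf 1$ with $X$). A partial inverse of $M$ is a subdistribution matrix $N$ of shape $(Y,X)$ with $MN=\overline M$ and $NM=\overline N$. *)

theory Defs
  imports Complex_Main "HOL-Library.FuncSet"
begin

text \<open>
  The index sets X, Y are arbitrary sets (possibly empty or infinite), so they are carrier sets
  rather than types. A function on a set is an extensional function; hence equality of matrices of
  shape (X, Y) is HOL equality.
\<close>

definition matrices :: "'x set \<Rightarrow> 'y set \<Rightarrow> ('x \<times> 'y \<Rightarrow> real) set" where
  "matrices X Y = (X \<times> Y \<rightarrow>\<^sub>E UNIV)"

definition mrow :: "'y set \<Rightarrow> ('x \<times> 'y \<Rightarrow> real) \<Rightarrow> 'x \<Rightarrow> 'y \<Rightarrow> real" where
  "mrow Y M x = (\<lambda>y\<in>Y. M (x, y))"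

text \<open>
  Sums over possibly infinite index sets are taken with \<^const>\<open>sum'\<close>, the sum over the elements with
  nonzero summand. It returns 0 if there are infinitely many of these, which does not happen
  in a matrix product whose left factor has finitely supported rows.
\<close>

definition subdistribution :: "'x set \<Rightarrow> ('x \<Rightarrow> real) \<Rightarrow> bool" where
  "subdistribution X p \<longleftrightarrow>
     p \<in> X \<rightarrow>\<^sub>E {0..1} \<and> finite {x \<in> X. p x \<noteq> 0} \<and> sum' p X \<le> 1"

definition unit_distribution :: "'y set \<Rightarrow> 'y \<Rightarrow> 'y \<Rightarrow> real" where
  "unit_distribution Y y = (\<lambda>y'\<in>Y. if y' = y then 1 else 0)"

definition subdistribution_matrix :: "'x set \<Rightarrow> 'y set \<Rightarrow> ('x \<times> 'y \<Rightarrow> real) \<Rightarrow> bool" where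
  "subdistribution_matrix X Y M \<longleftrightarrow>
     M \<in> matrices X Y \<and> (\<forall>x\<in>X. subdistribution Y (mrow Y M x))"

definition msupp :: "'x set \<Rightarrow> 'y set \<Rightarrow> ('x \<times> 'y \<Rightarrow> real) \<Rightarrow> 'x set" where
  "msupp X Y M = {x \<in> X. \<exists>y\<in>Y. M (x, y) \<noteq> 0}"

definition subpermutation_matrix :: "'x set \<Rightarrow> 'y set \<Rightarrow> ('x \<times> 'y \<Rightarrow> real) \<Rightarrow> bool" where
  "subpermutation_matrix X Y M \<longleftrightarrow>
     subdistribution_matrix X Y M \<and>
     (\<forall>x\<in>msupp X Y M. \<exists>y\<in>Y. mrow Y M x = unit_distribution Y y) \<and>
     (\<forall>x\<in>msupp X Y M. \<forall>x'\<in>msupp X Y M. mrow Y M x = mrow Y M x' \<longleftrightarrow> x = x')"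

definition mtranspose :: "'x set \<Rightarrow> 'y set \<Rightarrow> ('x \<times> 'y \<Rightarrow> real) \<Rightarrow> ('y \<times> 'x \<Rightarrow> real)" where
  "mtranspose X Y M = (\<lambda>(y, x)\<in>Y \<times> X. M (x, y))"

text \<open>Product, in diagrammatic order, of M of shape (X, Y) and N of shape (Y, Z).\<close>

definition mmult ::
    "'x set \<Rightarrow> 'y set \<Rightarrow> 'z set \<Rightarrow> ('x \<times> 'y \<Rightarrow> real) \<Rightarrow> ('y \<times> 'z \<Rightarrow> real) \<Rightarrow> ('x \<times> 'z \<Rightarrow> real)" where
  "mmult X Y Z M N = (\<lambda>(x, z)\<in>X \<times> Z. sum' (\<lambda>y. M (x, y) * N (y, z)) Y)"

definition mid :: "'x set \<Rightarrow> ('x \<times> 'x \<Rightarrow> real)" where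
  "mid X = (\<lambda>(x, x')\<in>X \<times> X. if x = x' then 1 else 0)"

text \<open>Kronecker product of M of shape (X, Y) and N of shape (U, V).\<close>

definition mkron ::
    "'x set \<Rightarrow> 'y set \<Rightarrow> 'u set \<Rightarrow> 'v set \<Rightarrow> ('x \<times> 'y \<Rightarrow> real) \<Rightarrow> ('u \<times> 'v \<Rightarrow> real)
      \<Rightarrow> (('x \<times> 'u) \<times> ('y \<times> 'v) \<Rightarrow> real)" where
  "mkron X Y U V M N = (\<lambda>((x, u), (y, v))\<in>(X \<times> U) \<times> (Y \<times> V). M (x, y) * N (u, v))"

definition mcopy :: "'x set \<Rightarrow> ('x \<times> ('x \<times> 'x) \<Rightarrow> real)" where
  "mcopy X = (\<lambda>(x, (x1, x2))\<in>X \<times> (X \<times> X). if x1 = x \<and> x = x2 then 1 else 0)"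

definition mdiscard :: "'y set \<Rightarrow> ('y \<times> unit \<Rightarrow> real)" where
  "mdiscard Y = (\<lambda>(y, u)\<in>Y \<times> {()}. 1)"

text \<open>
  The composite has shape (X, X \<open>\<times>\<close> 1); the outer abstraction relabels its columns
  along the bijection between X \<open>\<times>\<close> 1 and X.
\<close>

definition domain_of_definition ::
    "'x set \<Rightarrow> 'y set \<Rightarrow> ('x \<times> 'y \<Rightarrow> real) \<Rightarrow> ('x \<times> 'x \<Rightarrow> real)" where
  "domain_of_definition X Y M =
     (\<lambda>(x, x')\<in>X \<times> X.
        mmult X (X \<times> X) (X \<times> {()})
          (mcopy X)
          (mkron X X X {()} (mid X) (mmult X Y {()} M (mdiscard Y)))
          (x, (x', ())))"

definition partial_inverse ::
    "'x set \<Rightarrow> 'y set \<Rightarrow> ('x \<times> 'y \<Rightarrow> real) \<Rightarrow> ('y \<times> 'x \<Rightarrow> real) \<Rightarrow> bool" where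
  "partial_inverse X Y M N \<longleftrightarrow>
     subdistribution_matrix Y X N \<and>
     mmult X Y X M N = domain_of_definition X Y M \<and>
     mmult Y X Y N M = domain_of_definition Y X N"

definition partial_isomorphism :: "'x set \<Rightarrow> 'y set \<Rightarrow> ('x \<times> 'y \<Rightarrow> real) \<Rightarrow> bool" where
  "partial_isomorphism X Y M \<longleftrightarrow> (\<exists>N. partial_inverse X Y M N)"

end

theory Submission imports Defs begin

text \<open>
  If N is a partial inverse of M, the diagonal entries of MN say that
  \<open>\<Sum>y. M (x, y) * N (y, x) = \<Sum>y. M (x, y)\<close>. Since N has entries in [0, 1], this forces
  N (y, x) = 1 whenever M (x, y) \<open>\<noteq>\<close> 0, and the diagonal entries of NM give the same with M and N
  exchanged. So M is a 0/1 matrix, and two ones in a column of M would produce two ones in a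
  row of N, which has mass at most 1.
\<close>

lemma sum'_single:
  fixes f :: "'a \<Rightarrow> 'b::comm_monoid_add"
  assumes "a \<in> A" and "\<And>x. x \<in> A \<Longrightarrow> x \<noteq> a \<Longrightarrow> f x = 0"
  shows "sum' f A = f a"
proof -
  \<comment> \<open>The support is finite in both cases, so \<open>sum'\<close> does not fall back
    on its default value 0.\<close>
  have "{x \<in> A. f x \<noteq> 0} = (if f a = 0 then {} else {a})"
    using assms by auto
  then show ?thesis by (simp add: sum.G_def)
qed

text \<open>The two sums differ by the sum of \<open>f x * (1 - g x)\<close>, whose terms are
  nonnegative. As it is 0, every term is 0, and \<open>f a\<close> can be cancelled.\<close>

lemma weight_eq_1_if_weighted_sum'_eq:
  fixes f g :: "'a \<Rightarrow> real"
  assumes fin: "finite {x \<in> A. f x \<noteq> 0}"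
    and f: "\<And>x. x \<in> A \<Longrightarrow> 0 \<le> f x" and g: "\<And>x. x \<in> A \<Longrightarrow> g x \<le> 1"
    and eq: "sum' (\<lambda>x. f x * g x) A = sum' f A"
    and a: "a \<in> A" "f a \<noteq> 0"
  shows "g a = 1"
proof -
  define S where "S = {x \<in> A. f x \<noteq> 0}"
  \<comment> \<open>The product may also vanish where \<open>g\<close> does, so its support can be
    smaller than \<open>S\<close>; padding with zeros brings both sums over the same index
    set.\<close>
  have "{x \<in> A. f x * g x \<noteq> 0} \<subseteq> S" by (auto simp: S_def)
  moreover have "finite S" using fin by (simp add: S_def)
  ultimately have "sum' (\<lambda>x. f x * g x) A = (\<Sum>x\<in>S. f x * g x)"
    by (auto simp: sum.G_def S_def intro!: sum.mono_neutral_left dest: finite_subset)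
  moreover have "sum' f A = sum f S" using fin by (simp add: sum.G_def S_def)
  ultimately have "(\<Sum>x\<in>S. f x * (1 - g x)) = 0"
    using eq by (simp add: algebra_simps sum_subtractf)
  moreover have "0 \<le> f x * (1 - g x)" if "x \<in> S" for x
    using that f g by (simp add: S_def)
  ultimately have "f a * (1 - g a) = 0"
    using \<open>finite S\<close> a by (subst (asm) sum_nonneg_eq_0_iff) (auto simp: S_def)
  then show ?thesis using a by simp
qed

lemma subdistribution_eq_if_eq_1:
  assumes p: "subdistribution X p" and a: "a \<in> X" "p a = 1" and b: "b \<in> X" "p b \<noteq> 0"
  shows "a = b"
proof (rule ccontr)
  assume "a \<noteq> b"
  let ?S = "{x \<in> X. p x \<noteq> 0}"
  have nonneg: "0 \<le> p x" if "x \<in> X" for x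
    using p that by (auto simp: subdistribution_def PiE_iff)
  have fin: "finite ?S" and le: "sum p ?S \<le> 1"
    using p by (auto simp: subdistribution_def sum.G_def)
  \<comment> \<open>For distinct \<open>a\<close> and \<open>b\<close> the left side is
    \<open>1 + p b\<close>, which exceeds the total mass allowed.\<close>
  have "sum p {a, b} \<le> sum p ?S"
    using fin a b nonneg by (intro sum_mono2) auto
  moreover have "0 < p b" using nonneg b by force
  ultimately show False using \<open>a \<noteq> b\<close> a le by simp
qed

lemma subdistribution_matrix_rowD:
  assumes "subdistribution_matrix X Y M" "x \<in> X"
  shows "\<And>y. y \<in> Y \<Longrightarrow> 0 \<le> M (x, y)" "\<And>y. y \<in> Y \<Longrightarrow> M (x, y) \<le> 1"
    "finite {y \<in> Y. M (x, y) \<noteq> 0}"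
proof -
  have s: "subdistribution Y (mrow Y M x)"
    using assms by (simp add: subdistribution_matrix_def)
  then show "0 \<le> M (x, y)" "M (x, y) \<le> 1" if "y \<in> Y" for y
    using that by (auto simp: subdistribution_def PiE_iff mrow_def)
  have "{y \<in> Y. mrow Y M x y \<noteq> 0} = {y \<in> Y. M (x, y) \<noteq> 0}"
    by (auto simp: mrow_def)
  then show "finite {y \<in> Y. M (x, y) \<noteq> 0}"
    using s by (simp add: subdistribution_def)
qed

lemma subdistribution_matrix_row_eq_if_eq_1:
  assumes "subdistribution_matrix X Y M" "x \<in> X"
    and "y \<in> Y" "M (x, y) = 1" "y' \<in> Y" "M (x, y') \<noteq> 0"
  shows "y = y'"
  using assms subdistribution_eq_if_eq_1[of Y "mrow Y M x" y y']
  by (simp add: subdistribution_matrix_def mrow_def)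

text \<open>Copying leaves only the middle index \<open>(x, x)\<close>; there the identity factor
  contributes the Kronecker delta and discarding contributes the mass of row \<open>x\<close>. The
  result is the diagonal matrix of row masses.\<close>

lemma domain_of_definition_eq:
  "domain_of_definition X Y M =
    (\<lambda>(x, x')\<in>X \<times> X. if x = x' then sum' (\<lambda>y. M (x, y)) Y else 0)"
proof -
  have "mmult X (X \<times> X) (X \<times> {()}) (mcopy X)
          (mkron X X X {()} (mid X) (mmult X Y {()} M (mdiscard Y))) (x, (x', ()))
        = (if x = x' then sum' (\<lambda>y. M (x, y)) Y else 0)" (is "?l = _")
    if x: "x \<in> X" "x' \<in> X" for x x'
  proof -
    have "?l = mid X (x, x') * mmult X Y {()} M (mdiscard Y) (x, ())"
      using x by (simp add: mmult_def, subst sum'_single[of "(x, x)"])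
        (auto simp: mcopy_def mkron_def split: if_splits)
    moreover have "mmult X Y {()} M (mdiscard Y) (x, ()) = sum' (\<lambda>y. M (x, y)) Y"
      using x by (auto simp: mmult_def mdiscard_def intro!: sum.cong')
    ultimately show ?thesis using x by (simp add: mid_def)
  qed
  then show ?thesis
    by (auto simp: domain_of_definition_def fun_eq_iff restrict_def)
qed

text \<open>An entry 1 exhausts the mass of its row, so unit rows amount to entries 0 and 1. Two
  unit rows agree exactly when their ones share a column, so distinctness of rows becomes a
  condition on columns. This entrywise form is what transposition and the partial inverse equations
  can be compared with.\<close>

lemma subpermutation_matrix_iff:
  "subpermutation_matrix X Y M \<longleftrightarrow>
    subdistribution_matrix X Y M \<and>
    (\<forall>x\<in>X. \<forall>y\<in>Y. M (x, y) \<noteq> 0 \<longrightarrow> M (x, y) = 1) \<and>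
    (\<forall>x\<in>X. \<forall>x'\<in>X. \<forall>y\<in>Y. M (x, y) \<noteq> 0 \<longrightarrow> M (x', y) \<noteq> 0 \<longrightarrow> x = x')"
    (is "?L \<longleftrightarrow> ?M \<and> ?one \<and> ?inj")
proof (intro iffI conjI)
  assume L: ?L
  then show ?M by (simp add: subpermutation_matrix_def)
  have row: "mrow Y M x = unit_distribution Y y \<and> M (x, y) = 1"
    if xy: "x \<in> X" "y \<in> Y" "M (x, y) \<noteq> 0" for x y
  proof -
    have "x \<in> msupp X Y M" using xy by (auto simp: msupp_def)
    then obtain z where z: "mrow Y M x = unit_distribution Y z"
      using L by (auto simp: subpermutation_matrix_def)
    \<comment> \<open>The unit distribution at \<open>z\<close> is nonzero only at \<open>z\<close>,
      and the row is nonzero at \<open>y\<close>.\<close>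
    from fun_cong[OF z, of y] have "z = y \<and> M (x, y) = 1"
      using xy by (auto simp: mrow_def unit_distribution_def split: if_splits)
    with z show ?thesis by simp
  qed
  then show ?one by blast
  show ?inj
  proof (intro ballI impI)
    fix x x' y
    assume *: "x \<in> X" "x' \<in> X" "y \<in> Y" "M (x, y) \<noteq> 0" "M (x', y) \<noteq> 0"
    then have "mrow Y M x = mrow Y M x'" using row by metis
    moreover have "x \<in> msupp X Y M" "x' \<in> msupp X Y M" using * by (auto simp: msupp_def)
    ultimately show "x = x'" using L by (simp add: subpermutation_matrix_def)
  qed
next
  assume R: "?M \<and> ?one \<and> ?inj"
  have "\<exists>y\<in>Y. mrow Y M x = unit_distribution Y y" if "x \<in> msupp X Y M" for x
  proof -
    from that obtain y where y: "x \<in> X" "y \<in> Y" "M (x, y) \<noteq> 0" by (auto simp: msupp_def)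
    with R have 1: "M (x, y) = 1" by blast
    have "M (x, y') = 0" if "y' \<in> Y" "y' \<noteq> y" for y'
      using subdistribution_matrix_row_eq_if_eq_1[of X Y M x y y'] y R 1 that by blast
    with 1 have "mrow Y M x = unit_distribution Y y"
      by (auto simp: mrow_def unit_distribution_def fun_eq_iff restrict_def)
    with y show ?thesis by blast
  qed
  moreover have "x = x'"
    if "x \<in> msupp X Y M" "x' \<in> msupp X Y M" "mrow Y M x = mrow Y M x'" for x x'
  proof -
    from that(1) obtain y where y: "x \<in> X" "y \<in> Y" "M (x, y) \<noteq> 0" by (auto simp: msupp_def)
    \<comment> \<open>Equal rows are both nonzero in column \<open>y\<close>, which the column
      condition in \<open>R\<close> permits only for equal indices.\<close>
    with fun_cong[OF that(3), of y] have "M (x', y) \<noteq> 0" by (simp add: mrow_def)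
    with y that(2) R show ?thesis by (auto simp: msupp_def)
  qed
  ultimately show ?L using R by (auto simp: subpermutation_matrix_def)
qed

lemma mtranspose_mtranspose:
  assumes "M \<in> matrices X Y"
  shows "mtranspose Y X (mtranspose X Y M) = M"
  using assms
  by (auto simp: mtranspose_def matrices_def fun_eq_iff restrict_def PiE_iff extensional_def)

text \<open>Transposing swaps two bounds. At most one nonzero entry per column of \<open>M\<close>
  makes the rows of the transpose unit distributions or zero; at most one per row of
  \<open>M\<close>, by the mass bound, gives the column condition of the transpose.\<close>

lemma subpermutation_matrix_mtranspose:
  assumes M: "subpermutation_matrix X Y M"
  shows "subpermutation_matrix Y X (mtranspose X Y M)"
proof -
  note * = M[unfolded subpermutation_matrix_iff]
  have "subdistribution X (mrow X (mtranspose X Y M) y)" if y: "y \<in> Y" for y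
  proof (cases "\<exists>x\<in>X. M (x, y) \<noteq> 0")
    case True
    then obtain x where x: "x \<in> X" "M (x, y) \<noteq> 0" by blast
    then have "M (x, y) = 1" "\<And>x'. x' \<in> X \<Longrightarrow> x' \<noteq> x \<Longrightarrow> M (x', y) = 0"
      using * y by blast+
    then have row: "mrow X (mtranspose X Y M) y = unit_distribution X x"
      using x y by (auto simp: mrow_def mtranspose_def unit_distribution_def fun_eq_iff restrict_def)
    have "{x' \<in> X. unit_distribution X x x' \<noteq> 0} = {x}"
      using x by (auto simp: unit_distribution_def)
    moreover have "sum' (unit_distribution X x) X = 1"
      using x by (subst sum'_single[of x]) (auto simp: unit_distribution_def)
    ultimately show ?thesis
      unfolding row subdistribution_def by (auto simp: unit_distribution_def)
  next
    case False
    then have row: "mrow X (mtranspose X Y M) y = (\<lambda>x\<in>X. 0)"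
      using y by (auto simp: mrow_def mtranspose_def fun_eq_iff restrict_def)
    show ?thesis
      unfolding row subdistribution_def by (auto simp: sum.G_def)
  qed
  moreover have "mtranspose X Y M \<in> matrices Y X"
    by (auto simp: mtranspose_def matrices_def)
  ultimately have "subdistribution_matrix Y X (mtranspose X Y M)"
    by (simp add: subdistribution_matrix_def)
  moreover have "y = y'"
    if "x \<in> X" "y \<in> Y" "y' \<in> Y" "M (x, y) \<noteq> 0" "M (x, y') \<noteq> 0" for x y y'
    using subdistribution_matrix_row_eq_if_eq_1[of X Y M x y y'] that * by blast
  ultimately show ?thesis
    using * by (auto simp: subpermutation_matrix_iff mtranspose_def)
qed

text \<open>The summand is \<open>M (x, y) * M (x', y)\<close>. Off the diagonal it vanishes because
  no column has two nonzero entries; on the diagonal it is \<open>M (x, y)\<close> because 0 and 1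
  are their own squares.\<close>

lemma mmult_mtranspose_eq_domain_of_definition:
  assumes "subpermutation_matrix X Y M"
  shows "mmult X Y X M (mtranspose X Y M) = domain_of_definition X Y M"
proof -
  note * = assms[unfolded subpermutation_matrix_iff]
  have "sum' (\<lambda>y. M (x, y) * mtranspose X Y M (y, x')) Y
      = (if x = x' then sum' (\<lambda>y. M (x, y)) Y else 0)" if x: "x \<in> X" "x' \<in> X" for x x'
  proof -
    have "M (x, y) * mtranspose X Y M (y, x') = (if x = x' then M (x, y) else 0)"
      if "y \<in> Y" for y
    proof (cases "x = x'")
      case True
      have "M (x, y) = 0 \<or> M (x, y) = 1" using x that * by blast
      then show ?thesis using True x that by (auto simp: mtranspose_def)
    next
      case False
      then have "M (x, y) = 0 \<or> M (x', y) = 0" using x that * by blast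
      then show ?thesis using False x that by (auto simp: mtranspose_def)
    qed
    then have "sum' (\<lambda>y. M (x, y) * mtranspose X Y M (y, x')) Y
        = sum' (\<lambda>y. if x = x' then M (x, y) else 0) Y"
      by (intro sum.cong') auto
    then show ?thesis by (simp add: sum.G_def)
  qed
  then show ?thesis
    by (auto simp: mmult_def domain_of_definition_eq fun_eq_iff restrict_def)
qed

text \<open>The second equation is the first one applied to the transpose, whose own transpose is
  \<open>M\<close>.\<close>

lemma partial_inverse_mtranspose:
  assumes M: "subpermutation_matrix X Y M"
  shows "partial_inverse X Y M (mtranspose X Y M)"
proof -
  note T = subpermutation_matrix_mtranspose[OF M]
  have "mtranspose Y X (mtranspose X Y M) = M"
    using M by (intro mtranspose_mtranspose)
      (simp add: subpermutation_matrix_def subdistribution_matrix_def)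
  then show ?thesis
    using T mmult_mtranspose_eq_domain_of_definition[OF M]
      mmult_mtranspose_eq_domain_of_definition[OF T]
    by (simp add: partial_inverse_def subpermutation_matrix_def)
qed

lemma eq_1_if_mmult_eq_domain_of_definition:
  assumes M: "subdistribution_matrix X Y M" and N: "subdistribution_matrix Y X N"
    and eq: "mmult X Y X M N = domain_of_definition X Y M"
    and xy: "x \<in> X" "y \<in> Y" "M (x, y) \<noteq> 0"
  shows "N (y, x) = 1"
proof (rule weight_eq_1_if_weighted_sum'_eq[where f = "\<lambda>y. M (x, y)" and g = "\<lambda>y. N (y, x)" and A = Y])
  \<comment> \<open>Only the diagonal entry at \<open>(x, x)\<close> is used: weighting row
    \<open>x\<close> of \<open>M\<close> by column \<open>x\<close> of \<open>N\<close> preserves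
    its mass.\<close>
  show "sum' (\<lambda>y. M (x, y) * N (y, x)) Y = sum' (\<lambda>y. M (x, y)) Y"
    using fun_cong[OF eq, of "(x, x)"] xy by (simp add: mmult_def domain_of_definition_eq)
qed (use subdistribution_matrix_rowD[OF M] subdistribution_matrix_rowD[OF N] xy in auto)

lemma subpermutation_matrix_if_partial_inverse:
  assumes M: "subdistribution_matrix X Y M" and MN: "partial_inverse X Y M N"
  shows "subpermutation_matrix X Y M"
proof -
  have N: "subdistribution_matrix Y X N"
    and eq: "mmult X Y X M N = domain_of_definition X Y M"
      "mmult Y X Y N M = domain_of_definition Y X N"
    using MN by (auto simp: partial_inverse_def)
  have N1: "N (y, x) = 1" if "x \<in> X" "y \<in> Y" "M (x, y) \<noteq> 0" for x y
    using eq_1_if_mmult_eq_domain_of_definition[OF M N eq(1) that] .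
  \<comment> \<open>By \<open>N1\<close> the entry \<open>N (y, x)\<close> is nonzero, so the same
    argument runs with \<open>M\<close> and \<open>N\<close> exchanged.\<close>
  have "M (x, y) = 1" if "x \<in> X" "y \<in> Y" "M (x, y) \<noteq> 0" for x y
    using eq_1_if_mmult_eq_domain_of_definition[OF N M eq(2)] N1 that by simp
  moreover have "x = x'"
    if "x \<in> X" "x' \<in> X" "y \<in> Y" "M (x, y) \<noteq> 0" "M (x', y) \<noteq> 0" for x x' y
    \<comment> \<open>By \<open>N1\<close> both \<open>N (y, x)\<close> and \<open>N (y, x')\<close>
      are 1, and they lie in the same row of \<open>N\<close>.\<close>
    using subdistribution_matrix_row_eq_if_eq_1[OF N, of y x x'] N1 that by simp
  ultimately show ?thesis
    unfolding subpermutation_matrix_iff using M by blast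
qed

theorem proposition3p27:
  fixes X :: "'x set" and Y :: "'y set" and M :: "'x \<times> 'y \<Rightarrow> real"
  assumes "subdistribution_matrix X Y M"
  shows "(subpermutation_matrix X Y M \<longleftrightarrow> partial_isomorphism X Y M) \<and>
         (subpermutation_matrix X Y M \<longrightarrow> partial_inverse X Y M (mtranspose X Y M))"
  using partial_inverse_mtranspose subpermutation_matrix_if_partial_inverse[OF assms]
  by (auto simp: partial_isomorphism_def)

end
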